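(* Let $p$ be an odd prime with $p \equiv 7 \pmod{40}$ or $p \equiv 23 \pmod{40}$. Then the elliptic curve $E_p : y^2 = x^3 - 5px$ has rank zero over $\mathbb{Q}$, i.e. the Mordell–Weil group $E_p(\mathbb{Q})$ is finite.
   Context: The rank of an elliptic curve $E$ over a field $K$ is the rank $r$ of the finitely generated abelian group $E(K) \cong \mathbb{Z}^r \oplus E(K)_{\mathrm{tors}}$. *)

theory Defs
  imports "HOL-Number_Theory.Cong" "HOL-Algebra.Product_Groups"
begin

datatype 'a ec_point = Infinity | Affine 'a 'a

text \<open>The short Weierstrass equation \<open>y\<^sup>2 = x\<^sup>3 + a x + b\<close> defines an elliptic curve iff its
  discriminant \<open>-16 (4 a\<^sup>3 + 27 b\<^sup>2)\<close> does not vanish (in characteristic 0).\<close>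

definition ec_nonsingular :: "'a::field_char_0 \<Rightarrow> 'a \<Rightarrow> bool" where
  "ec_nonsingular a b \<longleftrightarrow> 4 * a ^ 3 + 27 * b ^ 2 \<noteq> 0"

definition ec_points :: "'a::field_char_0 \<Rightarrow> 'a \<Rightarrow> 'a ec_point set" where
  "ec_points a b = insert Infinity {Affine x y | x y. y ^ 2 = x ^ 3 + a * x + b}"

text \<open>The chord-and-tangent law; \<open>m\<close> is the slope of the line through the two points
  (the tangent if they coincide). On the curve, \<open>x1 = x2\<close> and \<open>y1 \<noteq> - y2\<close> imply
  \<open>y1 = y2 \<noteq> 0\<close>.\<close>

fun ec_add :: "'a::field_char_0 \<Rightarrow> 'a ec_point \<Rightarrow> 'a ec_point \<Rightarrow> 'a ec_point" where
  "ec_add a Infinity Q = Q"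
| "ec_add a (Affine x1 y1) Infinity = Affine x1 y1"
| "ec_add a (Affine x1 y1) (Affine x2 y2) =
    (if x1 = x2 \<and> y1 = - y2 then Infinity
     else
       let m = (if x1 = x2 then (3 * x1 ^ 2 + a) / (2 * y1) else (y2 - y1) / (x2 - x1));
           x3 = m ^ 2 - x1 - x2
       in Affine x3 (m * (x1 - x3) - y1))"

definition mordell_weil_group :: "'a::field_char_0 \<Rightarrow> 'a \<Rightarrow> 'a ec_point monoid" where
  "mordell_weil_group a b =
    \<lparr>carrier = ec_points a b, monoid.mult = ec_add a, one = Infinity\<rparr>"

definition torsion_part :: "('a, 'b) monoid_scheme \<Rightarrow> ('a, 'b) monoid_scheme" where
  "torsion_part G =
    G\<lparr>carrier := {x \<in> carrier G. \<exists>n::nat. n > 0 \<and> x [^]\<^bsub>G\<^esub> n = \<one>\<^bsub>G\<^esub>}\<rparr>"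

definition finitely_generated_group :: "('a, 'b) monoid_scheme \<Rightarrow> bool" where
  "finitely_generated_group G \<longleftrightarrow>
    (\<exists>S. finite S \<and> S \<subseteq> carrier G \<and> generate G S = carrier G)"

text \<open>\<open>G\<close> is a finitely generated abelian group with \<open>G \<cong> \<int>\<^sup>r \<oplus> G\<^sub>t\<^sub>o\<^sub>r\<^sub>s\<close>. A relation rather than
  a function, so that a group that is not finitely generated has no rank.\<close>

definition has_rank :: "('a, 'b) monoid_scheme \<Rightarrow> nat \<Rightarrow> bool" where
  "has_rank G r \<longleftrightarrow>
    comm_group G \<and> finitely_generated_group G \<and>
    G \<cong> product_group {..<r} (\<lambda>_. integer_group) \<times>\<times> torsion_part G"

definition E_group :: "nat \<Rightarrow> rat ec_point monoid" where
  "E_group p = mordell_weil_group (- 5 * of_nat p) 0"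

lemma E_nonsingular: "p > 0 \<Longrightarrow> ec_nonsingular (- 5 * of_nat p :: rat) 0"
  by (simp add: ec_nonsingular_def)

end

theory Submission
  imports Defs "HOL-Number_Theory.Residues" "HOL-Computational_Algebra.Nth_Powers"
begin

text \<open>
  The only rational points are \<open>\<infinity>\<close> and \<open>(0, 0)\<close>, so the associative law is only
  needed for a group of order two. Writing \<open>x = a/b\<close> in lowest terms, a point with \<open>x \<noteq> 0\<close> makes
  \<open>a b (a\<^sup>2 - 5 p b\<^sup>2)\<close> a square, which splits into \<open>n\<^sup>2 + h e\<^sup>4 = g m\<^sup>4\<close> with \<open>g h = 5 p\<close>. All these quartics
  have a local obstruction at \<open>5\<close> or \<open>p\<close> except \<open>n\<^sup>2 + 5 p e\<^sup>4 = m\<^sup>4\<close>, to which infinite descent along the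
  2-isogeny with \<open>y\<^sup>2 = x\<^sup>3 + 20 p x\<close> applies: factoring \<open>m\<^sup>4 - n\<^sup>2\<close> leads to \<open>m\<^sup>2 = u\<^sup>4 + 20 p v\<^sup>4\<close>, and factoring
  \<open>m\<^sup>2 - u\<^sup>4\<close> leads back to \<open>u\<^sup>2 + 5 p r\<^sup>4 = s\<^sup>4\<close> with a smaller \<open>r\<close>; the other factorisations are
  excluded modulo \<open>4\<close>, \<open>5\<close>, \<open>8\<close> or \<open>p\<close>.
\<close>

section \<open>Elementary tools: coprime factorisations, sums of two squares, residues modulo
  5\<close>

text \<open>Split off \<open>d = gcd X k\<close>. The cofactor of \<open>d\<close> in
  \<open>k\<close> is coprime to the cofactor \<open>X'\<close> in \<open>X\<close>, so it divides
  \<open>Y\<close>. What remains are coprime numbers with product \<open>z ^ n\<close>, hence both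
  are \<open>n\<close>-th powers. For \<open>k = 1\<close> this makes \<open>X\<close> and
  \<open>Y\<close> themselves \<open>n\<close>-th powers.\<close>

lemma coprime_mult_eq_mult_power_nat:
  fixes X Y k z n :: nat
  assumes "coprime X Y" and XY: "X * Y = k * z ^ n" and "k > 0" and "n > 0"
  obtains d d' u v where "X = d * u ^ n" "Y = d' * v ^ n" "d * d' = k" "u * v = z"
proof -
  have "gcd X k \<noteq> 0" using \<open>k > 0\<close> by simp
  then obtain X' k' where X: "X = X' * gcd X k" and k: "k = k' * gcd X k" and "coprime X' k'"
    using gcd_coprime_exists by blast
  define d where "d = gcd X k"
  have "d > 0" using \<open>k > 0\<close> by (simp add: d_def)
  have "d * (X' * Y) = d * (k' * z ^ n)"
    using XY X k unfolding d_def[symmetric] by (metis mult.assoc mult.commute)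
  then have *: "X' * Y = k' * z ^ n" using \<open>d > 0\<close> by simp
  then have "k' dvd Y" using \<open>coprime X' k'\<close>
    by (metis coprime_commute coprime_dvd_mult_right_iff dvd_triv_left)
  then obtain Y' where Y: "Y = k' * Y'" by blast
  have "k' > 0" using k \<open>k > 0\<close> by (metis gr0I mult_zero_left)
  then have z: "X' * Y' = z ^ n" using * Y by simp
  have "coprime X' Y'" using \<open>coprime X Y\<close> X Y
    by (metis coprime_mult_left_iff coprime_mult_right_iff)
  then have "is_nth_power n X'" "is_nth_power n Y'"
    using z is_nth_power_mult_coprime_nat_iff[of X' Y' n] by auto
  then obtain u v where u: "X' = u ^ n" and v: "Y' = v ^ n" by (auto simp: is_nth_power_def)
  have "(u * v) ^ n = z ^ n" using z u v by (simp add: power_mult_distrib)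
  then have "u * v = z" using \<open>n > 0\<close> power_eq_imp_eq_base by blast
  with that[of d u k' v] X Y k u v show ?thesis unfolding d_def[symmetric]
    by (simp add: mult.commute)
qed

text \<open>\<open>-1\<close> is a nonresidue modulo \<open>p\<close>: otherwise \<open>x\<close>
  and \<open>y\<close> are units, and raising \<open>x^2 = -y^2\<close> to the odd power
  \<open>(p - 1) / 2\<close> gives \<open>1 = -1\<close> by Fermat.\<close>

lemma prime_dvd_sum_squares_nat:
  fixes p x y :: nat
  assumes "prime p" "p mod 4 = 3" and dvd: "p dvd x ^ 2 + y ^ 2"
  shows "p dvd y"
proof (rule ccontr)
  assume y: "\<not> p dvd y"
  have x: "\<not> p dvd x"
  proof
    assume "p dvd x"
    then have "p dvd x ^ 2" by (simp add: power2_eq_square)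
    then have "p dvd y ^ 2" using dvd dvd_add_right_iff by blast
    with y \<open>prime p\<close> show False using prime_dvd_power by blast
  qed
  define h where "h = (p - 1) div 2"
  have "odd h" and h: "2 * h = p - 1" using \<open>p mod 4 = 3\<close> unfolding h_def by presburger+
  have "[int x ^ 2 = - (int y ^ 2)] (mod int p)"
    using dvd by (simp add: cong_iff_dvd_diff flip: of_nat_power of_nat_add)
  then have "[(int x ^ 2) ^ h = (- (int y ^ 2)) ^ h] (mod int p)" by (rule cong_pow)
  then have "[int x ^ (p - 1) = - (int y ^ (p - 1))] (mod int p)"
    using \<open>odd h\<close> by (simp add: power_mult[symmetric] h)
  moreover have "[int x ^ (p - 1) = 1] (mod int p)" "[int y ^ (p - 1) = 1] (mod int p)"
    using fermat_theorem[OF \<open>prime p\<close> x] fermat_theorem[OF \<open>prime p\<close> y]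
    by (metis cong_int_iff of_nat_1 of_nat_power)+
  ultimately have "[1 = - 1] (mod int p)"
    by (meson cong_minus_minus_iff cong_sym cong_trans)
  then have "int p dvd 2" by (simp add: cong_iff_dvd_diff)
  then have "p dvd 2" by (metis int_dvd_int_iff of_nat_numeral)
  then have "p \<le> 2" by (simp add: dvd_imp_le)
  with \<open>p mod 4 = 3\<close> show False by (cases "p = 0 \<or> p = 1 \<or> p = 2") auto
qed

text \<open>If \<open>t\<close> is a unit modulo 5, then \<open>t^4 = 1\<close> and
  \<open>n^2\<close> is congruent to the nonresidue \<open>c\<close>. Otherwise 5 divides
  \<open>t\<close> and \<open>n\<close>, so 25 divides \<open>5 * k * m^4\<close>, and 5 divides
  \<open>m\<close> as well.\<close>

lemma nonresidue_quartic_mod_5: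
  fixes c k n t m :: int
  assumes c: "c mod 5 = 2 \<or> c mod 5 = 3" and eq: "n ^ 2 = c * t ^ 4 + 5 * k * m ^ 4"
    and "\<not> 5 dvd k" and "coprime t m"
  shows False
proof -
  have pr: "prime (5::int)" by simp
  have "5 dvd t"
  proof (rule ccontr)
    assume "\<not> 5 dvd t"
    then have "t mod 5 = 1 \<or> t mod 5 = 2 \<or> t mod 5 = 3 \<or> t mod 5 = 4" by presburger
    then have "t ^ 4 mod 5 = 1" by (auto simp: power_mod[of t, symmetric])
    then have "n ^ 2 mod 5 = c mod 5" unfolding eq
      by (metis mod_mult_right_eq mod_mult_self2 mult.right_neutral mult.assoc)
    moreover have "n mod 5 = 0 \<or> n mod 5 = 1 \<or> n mod 5 = 2 \<or> n mod 5 = 3 \<or> n mod 5 = 4"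
      by presburger
    then have "n ^ 2 mod 5 = 0 \<or> n ^ 2 mod 5 = 1 \<or> n ^ 2 mod 5 = 4"
      by (auto simp: power_mod[of n, symmetric])
    ultimately show False using c by auto
  qed
  then obtain s where s: "t = 5 * s" by blast
  have "5 dvd n ^ 2" unfolding eq s by (simp add: power_mult_distrib mult.assoc)
  then have "5 dvd n" using pr prime_dvd_power by blast
  then obtain r where r: "n = 5 * r" by blast
  have "k * m ^ 4 = 5 * (r ^ 2 - 25 * c * s ^ 4)"
    using eq unfolding s r by (simp add: power_mult_distrib)
  then have "5 dvd k * m ^ 4" by simp
  then have "5 dvd m" using \<open>\<not> 5 dvd k\<close> pr by (meson prime_dvd_mult_iff prime_dvd_power)
  with \<open>5 dvd t\<close> \<open>coprime t m\<close> show False using coprime_common_divisor[of t m 5] by simp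
qed

lemma mult_eq_5_prime_cases:
  fixes g h p :: nat
  assumes "prime p" "g * h = 5 * p"
  shows "g = 1 \<and> h = 5 * p \<or> g = 5 \<and> h = p \<or> g = p \<and> h = 5 \<or> g = 5 * p \<and> h = 1"
proof -
  have five: "a = 1 \<and> b = 5 \<or> a = 5 \<and> b = 1" if "a * b = 5" for a b :: nat
  proof -
    have "a dvd 5" using that by (metis dvd_triv_left)
    then have "a = 1 \<or> a = 5" using prime_nat_iff[of 5] by simp
    with that show ?thesis by auto
  qed
  have "p > 0" using \<open>prime p\<close> by (rule prime_gt_0_nat)
  have "p dvd g * h" using assms by simp
  then consider "p dvd g" | "p dvd h" using \<open>prime p\<close> prime_dvd_mult_iff by blast
  then show ?thesis
  proof cases
    case 1
    then obtain a where a: "g = p * a" by blast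
    then have "a * h = 5" using assms(2) \<open>p > 0\<close> by simp
    from five[OF this] a show ?thesis by auto
  next
    case 2
    then obtain a where a: "h = p * a" by blast
    then have "g * a = 5" using assms(2) \<open>p > 0\<close> by simp
    from five[OF this] a show ?thesis by auto
  qed
qed

text \<open>Coprimality keeps the factor 4 of 20 in one piece, which leaves four splittings up to
  order.\<close>

lemma coprime_mult_eq_20_prime_cases:
  fixes d d' p :: nat
  assumes "prime p" "d * d' = 20 * p" "coprime d d'"
  shows "(d, d') \<in> {(1, 20 * p), (4, 5 * p), (5, 4 * p), (20, p)} \<or>
    (d', d) \<in> {(1, 20 * p), (4, 5 * p), (5, 4 * p), (20, p)}"
proof -
  have twenty: "(a, b) \<in> {(1, 20), (4, 5), (5, 4), (20, 1)}" if "a * b = 20" "coprime a b" for a b :: nat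
  proof -
    have "a \<le> 20" using that(1) by (metis dvd_imp_le dvd_triv_left zero_less_numeral)
    then have "a = 0 \<or> a = 1 \<or> a = 2 \<or> a = 3 \<or> a = 4 \<or> a = 5 \<or> a = 6 \<or> a = 7 \<or> a = 8 \<or>
        a = 9 \<or> a = 10 \<or> a = 11 \<or> a = 12 \<or> a = 13 \<or> a = 14 \<or> a = 15 \<or> a = 16 \<or> a = 17 \<or>
        a = 18 \<or> a = 19 \<or> a = 20" by presburger
    then have "a = 1 \<and> b = 20 \<or> a = 2 \<and> b = 10 \<or> a = 4 \<and> b = 5 \<or> a = 5 \<and> b = 4 \<or>
       a = 10 \<and> b = 2 \<or> a = 20 \<and> b = 1" using that(1) by (elim disjE) (simp_all, presburger+)
    moreover have "\<not> coprime (2::nat) 10" "\<not> coprime (10::nat) 2" by simp_all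
    ultimately show ?thesis using that(2) by auto
  qed
  have "p > 0" using \<open>prime p\<close> by (rule prime_gt_0_nat)
  have "p dvd d * d'" using assms by simp
  then consider "p dvd d" | "p dvd d'" using \<open>prime p\<close> prime_dvd_mult_iff by blast
  then show ?thesis
  proof cases
    case 1
    then obtain a where a: "d = p * a" by blast
    then have "a * d' = 20" using assms(2) \<open>p > 0\<close> by simp
    moreover have "coprime a d'" using assms(3) a by simp
    ultimately show ?thesis using twenty[of a d'] a by auto
  next
    case 2
    then obtain a where a: "d' = p * a" by blast
    then have "d * a = 20" using assms(2) \<open>p > 0\<close> by simp
    moreover have "coprime d a" using assms(3) a by simp
    ultimately show ?thesis using twenty[of d a] a by auto
  qed
qed

lemma coprimeI_prime_nat:
  fixes a b :: nat
  assumes "\<And>q. prime q \<Longrightarrow> q dvd a \<Longrightarrow> q dvd b \<Longrightarrow> False"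
  shows "coprime a b"
proof (rule ccontr)
  assume "\<not> coprime a b"
  then have "gcd a b \<noteq> 1" by (simp add: coprime_iff_gcd_eq_1)
  then obtain q where "prime q" "q dvd gcd a b" using prime_factor_nat by blast
  with assms show False by auto
qed

lemma prime_not_dvd_both:
  fixes a b q :: nat
  assumes "coprime a b" "prime q"
  shows "\<not> (q dvd a \<and> q dvd b)"
  using assms coprime_common_divisor not_prime_unit by blast

section \<open>Local obstructions for the quartics, with \<open>p\<close> a nonresidue modulo
  5\<close>

context
  fixes p :: nat
  assumes prime: "prime p" and p_mod_8: "p mod 8 = 7" and p_mod_5: "p mod 5 = 2 \<or> p mod 5 = 3"
begin

lemma p_pos: "p > 0"
  using prime by (rule prime_gt_0_nat)

lemma p_mod_4: "p mod 4 = 3"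
  using p_mod_8 by presburger

lemma coprime_p_5: "coprime p 5"
proof -
  have "\<not> 5 dvd p" using p_mod_5 by presburger
  then show ?thesis using prime_imp_coprime[of 5 p] by (simp add: coprime_commute)
qed

lemma int_p_mod_5: "int p mod 5 = 2 \<or> int p mod 5 = 3"
  using p_mod_5 by presburger

text \<open>For \<open>(g, h) = (5, p)\<close> and \<open>(p, 5)\<close> the obstruction is at 5,
  since \<open>p\<close> and \<open>-p\<close> are both nonresidues there. For
  \<open>(5 * p, 1)\<close> it is at \<open>p\<close>, which would divide a sum of two
  squares.\<close>

lemma minus_quartic_descent_coefficients:
  fixes g h m e n :: nat
  assumes gh: "g * h = 5 * p" and "coprime m e" and eq: "n ^ 2 + h * e ^ 4 = g * m ^ 4"
  shows "g = 1 \<and> h = 5 * p"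
proof -
  have int_eq: "int n ^ 2 + int h * int e ^ 4 = int g * int m ^ 4"
    using eq by (metis of_nat_add of_nat_mult of_nat_power)
  have cop: "coprime (int m) (int e)" "coprime (int e) (int m)"
    using \<open>coprime m e\<close> by (simp_all add: coprime_commute)
  consider "g = 1" "h = 5 * p" | "g = 5" "h = p" | "g = p" "h = 5" | "g = 5 * p" "h = 1"
    using mult_eq_5_prime_cases[OF prime gh] by blast
  then show ?thesis
  proof cases
    case 1
    then show ?thesis by simp
  next
    case 2
    have "(- int p) mod 5 = 2 \<or> (- int p) mod 5 = 3" using int_p_mod_5 by presburger
    moreover have "int n ^ 2 = (- int p) * int e ^ 4 + 5 * 1 * int m ^ 4"
      using int_eq 2 by simp
    ultimately have False by (rule nonresidue_quartic_mod_5[OF _ _ _ cop(2)]) simp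
    then show ?thesis ..
  next
    case 3
    have "int n ^ 2 = int p * int m ^ 4 + 5 * (- 1) * int e ^ 4"
      using int_eq 3 by simp
    with int_p_mod_5 have False by (rule nonresidue_quartic_mod_5[OF _ _ _ cop(1)]) simp
    then show ?thesis ..
  next
    case 4
    then have sum: "n ^ 2 + (e ^ 2) ^ 2 = p * (5 * m ^ 4)" using eq by simp
    then have "p dvd n ^ 2 + (e ^ 2) ^ 2" by simp
    with prime_dvd_sum_squares_nat[OF prime p_mod_4, of n "e ^ 2"]
      prime_dvd_sum_squares_nat[OF prime p_mod_4, of "e ^ 2" n]
    have "p dvd e ^ 2" and "p dvd n" by (simp_all add: add.commute)
    then have "p dvd e" using prime prime_dvd_power by blast
    \<comment> \<open>The left side of \<open>sum\<close> is divisible by \<open>p^2\<close> while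
      the right side shows a single \<open>p\<close>, so another one must come from
      \<open>m\<close>.\<close>
    have "p * p dvd n ^ 2" "p * p dvd (e ^ 2) ^ 2"
      using \<open>p dvd n\<close> \<open>p dvd e ^ 2\<close> by (simp_all add: power2_eq_square mult_dvd_mono)
    then have "p * p dvd p * (5 * m ^ 4)" using sum dvd_add by metis
    then have "p dvd 5 * m ^ 4" using p_pos by simp
    then have "p dvd m ^ 4" using coprime_p_5 coprime_dvd_mult_right_iff by blast
    then have "p dvd m" using prime prime_dvd_power by blast
    with \<open>p dvd e\<close> \<open>coprime m e\<close> prime show ?thesis
      using coprime_common_divisor not_prime_unit by blast
  qed
qed

text \<open>Up to order, \<open>(4, 5 * p)\<close> fails modulo 4, where \<open>M\<close> and
  \<open>y\<close> are odd and \<open>5 * p\<close> is 3. The pairs \<open>(5, 4 * p)\<close> and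
  \<open>(20, p)\<close> fail modulo 5, where \<open>4 * p\<close> and \<open>p\<close> are
  nonresidues.\<close>

lemma plus_quartic_descent_coefficients:
  fixes d d' u v M :: nat
  assumes "d * d' = 20 * p" "coprime d d'" "coprime u v" "odd M"
    and eq: "M ^ 2 = d * u ^ 4 + d' * v ^ 4"
  shows "d = 1 \<and> d' = 20 * p \<or> d = 20 * p \<and> d' = 1"
proof -
  have *: "a = 1 \<and> b = 20 * p"
    if ab: "(a, b) \<in> {(1, 20 * p), (4, 5 * p), (5, 4 * p), (20, p)}" and "coprime x y"
      and eq: "M ^ 2 = a * x ^ 4 + b * y ^ 4" for a b x y :: nat
  proof -
    have int_eq: "int M ^ 2 = int a * int x ^ 4 + int b * int y ^ 4"
      using eq by (metis of_nat_add of_nat_mult of_nat_power)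
    have cop: "coprime (int x) (int y)" "coprime (int y) (int x)"
      using \<open>coprime x y\<close> by (simp_all add: coprime_commute)
    have "(a, b) = (4, 5 * p) \<Longrightarrow> False"
    proof -
      assume ab: "(a, b) = (4, 5 * p)"
      then have eq': "M ^ 2 = 4 * x ^ 4 + 5 * p * y ^ 4" using eq by simp
      have "odd (M ^ 2)" using \<open>odd M\<close> by simp
      then have "odd y" unfolding eq' by (auto simp: p_pos)
      obtain k where k: "y = 2 * k + 1" using \<open>odd y\<close> by (rule oddE)
      obtain l where l: "M = 2 * l + 1" using \<open>odd M\<close> by (rule oddE)
      have "y ^ 4 = 4 * (4 * k ^ 4 + 8 * k ^ 3 + 6 * k ^ 2 + 2 * k) + 1"
        unfolding k by (simp add: power4_eq_xxxx power3_eq_cube power2_eq_square algebra_simps)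
      moreover have "M ^ 2 = 4 * (l ^ 2 + l) + 1" unfolding l by (simp add: power2_eq_square algebra_simps)
      moreover obtain q where "p = 4 * q + 3" using p_mod_4 by (metis mult_div_mod_eq)
      ultimately have "4 * (l ^ 2 + l) + 1 = 4 * x ^ 4 +
          5 * (4 * q + 3) * (4 * (4 * k ^ 4 + 8 * k ^ 3 + 6 * k ^ 2 + 2 * k) + 1)"
        using eq' by simp
      \<comment> \<open>The constant \<open>5 * 3 = 15\<close> is split as \<open>4 * 3 + 3\<close>,
        which exhibits remainder 3 against remainder 1 on the left.\<close>
      also have "\<dots> = 4 * (x ^ 4 + 5 * (4 * q + 3) * (4 * k ^ 4 + 8 * k ^ 3 + 6 * k ^ 2 + 2 * k)
          + 5 * q + 3) + 3" by (simp add: algebra_simps)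
      finally show False by presburger
    qed
    moreover have "(a, b) = (5, 4 * p) \<Longrightarrow> False"
    proof -
      assume ab: "(a, b) = (5, 4 * p)"
      have "(4 * int p) mod 5 = 2 \<or> (4 * int p) mod 5 = 3" using int_p_mod_5 by presburger
      moreover have "int M ^ 2 = (4 * int p) * int y ^ 4 + 5 * 1 * int x ^ 4"
        using int_eq ab by simp
      ultimately show False by (rule nonresidue_quartic_mod_5[OF _ _ _ cop(2)]) simp
    qed
    moreover have "(a, b) = (20, p) \<Longrightarrow> False"
    proof -
      assume ab: "(a, b) = (20, p)"
      have "int M ^ 2 = int p * int y ^ 4 + 5 * 4 * int x ^ 4"
        using int_eq ab by simp
      with int_p_mod_5 show False by (rule nonresidue_quartic_mod_5[OF _ _ _ cop(2)]) simp
    qed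
    ultimately show ?thesis using ab by auto
  qed
  have "coprime v u" "M ^ 2 = d' * v ^ 4 + d * u ^ 4"
    using \<open>coprime u v\<close> eq by (simp_all add: coprime_commute add.commute)
  with coprime_mult_eq_20_prime_cases[OF prime assms(1,2)] show ?thesis
    using *[OF _ \<open>coprime u v\<close> eq] *[of d' d v u] by blast
qed

text \<open>The coefficients \<open>1, 5 * p\<close> are excluded modulo 5. For \<open>5, p\<close>
  the right side is \<open>5 + 7 = 12\<close> modulo 8, so \<open>M^2\<close> would be 2 modulo 4;
  here \<open>p mod 8 = 7\<close> enters, not only \<open>p mod 4 = 3\<close>.\<close>

lemma odd_twisted_quartic:
  fixes d d' u v M :: nat
  assumes dd': "d * d' = 5 * p" and "coprime u v" "odd u" "odd v"
    and eq: "2 * M ^ 2 = d * u ^ 4 + d' * v ^ 4"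
  shows False
proof -
  have *: False if ab: "(a, b) = (1, 5 * p) \<or> (a, b) = (5, p)" and "coprime x y" "odd x" "odd y"
      and eq: "2 * M ^ 2 = a * x ^ 4 + b * y ^ 4" for a b x y :: nat
    using ab
  proof
    assume ab: "(a, b) = (1, 5 * p)"
    have int_eq: "2 * int M ^ 2 = int a * int x ^ 4 + int b * int y ^ 4"
      using eq by (metis of_nat_add of_nat_mult of_nat_power of_nat_numeral)
    \<comment> \<open>Doubling the equation makes the left side a square and puts the nonresidue 2
      in front of \<open>x^4\<close>.\<close>
    have "(2 * int M) ^ 2 = 2 * int x ^ 4 + 5 * (2 * int p) * int y ^ 4"
      using int_eq ab by (simp add: power_mult_distrib)
    moreover have "\<not> 5 dvd 2 * int p" using int_p_mod_5 by presburger
    moreover have "coprime (int x) (int y)" using \<open>coprime x y\<close> by simp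
    ultimately show False using nonresidue_quartic_mod_5[of 2 "2 * int M" "int x" "2 * int p" "int y"]
      by simp
  next
    assume ab: "(a, b) = (5, p)"
    have fourth: "\<exists>k. z ^ 4 = 8 * k + 1" if "odd z" for z :: nat
    proof -
      obtain k where k: "z = 2 * k + 1" using \<open>odd z\<close> by (rule oddE)
      have "even (k * (k + 1))" by simp
      then obtain j where j: "k * (k + 1) = 2 * j" by blast
      have "z ^ 2 = 4 * (k * (k + 1)) + 1" unfolding k by (simp add: power2_eq_square algebra_simps)
      then have "z ^ 2 = 8 * j + 1" using j by simp
      then have "z ^ 4 = (8 * j + 1) ^ 2" by (metis mult_2_right numeral_Bit0 power_mult power2_eq_square)
      also have "\<dots> = 8 * (8 * j ^ 2 + 2 * j) + 1" by (simp add: power2_eq_square algebra_simps)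
      finally show ?thesis by blast
    qed
    obtain k l where "x ^ 4 = 8 * k + 1" "y ^ 4 = 8 * l + 1"
      using fourth[OF \<open>odd x\<close>] fourth[OF \<open>odd y\<close>] by blast
    moreover obtain q where "p = 8 * q + 7" using p_mod_8 by (metis mult_div_mod_eq)
    ultimately have "2 * M ^ 2 = 5 * (8 * k + 1) + (8 * q + 7) * (8 * l + 1)" using eq ab by simp
    also have "\<dots> = 2 * (4 * (5 * k + 8 * q * l + q + 7 * l + 1) + 2)" by (simp add: algebra_simps)
    finally have M: "M ^ 2 = 4 * (5 * k + 8 * q * l + q + 7 * l + 1) + 2" by simp
    then have "even (M ^ 2)" by simp
    then have "even M" by simp
    then obtain r where "M = 2 * r" by blast
    then have "M ^ 2 = 4 * r ^ 2" by (simp add: power_mult_distrib)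
    with M show False by presburger
  qed
  have "(d, d') = (1, 5 * p) \<or> (d, d') = (5, p) \<or> (d', d) = (1, 5 * p) \<or> (d', d) = (5, p)"
    using mult_eq_5_prime_cases[OF prime dd'] by auto
  then show False
    using *[of d d' u v] *[of d' d v u] assms(2-4) eq by (auto simp: coprime_commute add.commute)
qed

section \<open>Infinite descent on \<open>N^2 + 5 p e^4 = M^4\<close>\<close>

text \<open>A common prime \<open>q\<close> of \<open>M\<close> and \<open>N\<close> does not divide
  \<open>e\<close>, so \<open>q^2\<close> would divide \<open>5 * p\<close>, which is squarefree
  because \<open>p\<close> is coprime to 5.\<close>

lemma quartic_prime_coprime:
  fixes M N e q :: nat
  assumes "prime q" "q dvd M" "coprime M e" and eq: "N ^ 2 + 5 * p * e ^ 4 = M ^ 4"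
  shows "\<not> q dvd N"
proof
  assume "q dvd N"
  then have "q * q dvd N ^ 2" by (simp add: power2_eq_square mult_dvd_mono)
  moreover have "q * q dvd M * M * (M * M)" using \<open>q dvd M\<close> by (intro dvd_mult mult_dvd_mono)
  then have "q * q dvd M ^ 4" by (simp add: power4_eq_xxxx mult.assoc)
  ultimately have "q * q dvd 5 * p * e ^ 4" using eq by (metis dvd_add_right_iff)
  moreover have "\<not> q dvd e" using assms(1-3) coprime_common_divisor not_prime_unit by blast
  then have "coprime (q * q) (e ^ 4)" using \<open>prime q\<close> by (simp add: prime_imp_coprime)
  ultimately have dvd: "q * q dvd 5 * p" using coprime_dvd_mult_left_iff by blast
  then obtain c where "5 * p = q * (q * c)" unfolding dvd_def mult.assoc by blast
  from mult_eq_5_prime_cases[OF prime this[symmetric]] \<open>prime q\<close>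
  have "q = 5 \<and> q * c = p \<or> q = p \<and> q * c = 5 \<or> q * c = 1" by auto
  moreover have "\<not> 5 dvd p" using p_mod_5 by presburger
  moreover have "\<not> p dvd 5" using prime_not_dvd_both[OF coprime_p_5 prime] by auto
  moreover have "q \<noteq> 1" using \<open>prime q\<close> by auto
  ultimately show False by (elim disjE conjE) (metis dvd_triv_left, metis dvd_triv_left, simp)
qed

text \<open>Factor \<open>5 * p * e^4\<close> as \<open>(M^2 - N) * (M^2 + N)\<close>. For odd
  \<open>e\<close> the factors are coprime with sum \<open>2 * M^2\<close>, contradicting
  \<open>odd_twisted_quartic\<close>. For even \<open>e\<close> their halves are coprime with sum
  \<open>M^2\<close>, and \<open>plus_quartic_descent_coefficients\<close> leaves one form.\<close>

lemma quartic_first_descent: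
  fixes M N e :: nat
  assumes "coprime M e" "e > 0" and eq: "N ^ 2 + 5 * p * e ^ 4 = M ^ 4"
  obtains u v where "M ^ 2 = u ^ 4 + 20 * p * v ^ 4" "e = 2 * (u * v)"
proof -
  have "0 < 5 * p * e ^ 4" using p_pos \<open>e > 0\<close> by simp
  then have "N ^ 2 < M ^ 4" using eq by linarith
  then have "N ^ 2 < (M ^ 2) ^ 2" by (simp flip: power_mult)
  then have "N < M ^ 2" using power_less_imp_less_base by blast
  define X Y where "X = M ^ 2 - N" and "Y = M ^ 2 + N"
  have X: "M ^ 2 = X + N" using \<open>N < M ^ 2\<close> by (simp add: X_def)
  have Y: "Y = X + 2 * N" using X by (simp add: Y_def)
  have sum: "X + Y = 2 * M ^ 2" using X Y by simp
  have "N ^ 2 + X * Y = (M ^ 2) ^ 2" unfolding X Y by (simp add: power2_eq_square algebra_simps)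
  then have XY: "X * Y = 5 * p * e ^ 4" using eq by (simp flip: power_mult)
  have prime_factor: "\<not> (q dvd M \<and> q dvd N)" if "prime q" for q
    using quartic_prime_coprime[OF that _ \<open>coprime M e\<close> eq] by blast
  show ?thesis
  proof (cases "even e")
    case False
    have "odd p" using p_mod_8 by presburger
    then have "odd (X * Y)" using False by (simp add: XY)
    then have "odd X" "odd Y" by simp_all
    have "coprime X Y"
    proof (rule coprimeI_prime_nat)
      fix q assume q: "prime q" "q dvd X" "q dvd Y"
      then have "q dvd 2 * M ^ 2" "q dvd 2 * N" using sum Y by (metis dvd_add, metis dvd_add_right_iff)
      moreover have "\<not> q dvd 2" using q \<open>odd X\<close>
        by (metis primes_dvd_imp_eq two_is_prime_nat)
      ultimately have "q dvd M" "q dvd N"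
        using q(1) prime_dvd_mult_iff prime_dvd_power by blast+
      with prime_factor q(1) show False by blast
    qed
    then obtain d d' u v where *: "X = d * u ^ 4" "Y = d' * v ^ 4" "d * d' = 5 * p" "u * v = e"
      using coprime_mult_eq_mult_power_nat[OF _ XY] p_pos by (metis mult_pos_pos zero_less_numeral)
    have "coprime u v" using \<open>coprime X Y\<close> * by simp
    moreover have "odd u" "odd v" using * False by auto
    moreover have "2 * M ^ 2 = d * u ^ 4 + d' * v ^ 4" using sum * by simp
    ultimately show ?thesis using odd_twisted_quartic * by blast
  next
    case True
    then obtain f where f: "e = 2 * f" by blast
    have "odd M" using True \<open>coprime M e\<close>
      by (metis coprime_common_divisor odd_one)
    have "odd (N ^ 2 + 5 * p * e ^ 4)" using \<open>odd M\<close> by (simp add: eq)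
    then have "odd N" using True by simp
    have "odd (X + N)" using \<open>odd M\<close> by (simp flip: X)
    then have "even X" using \<open>odd N\<close> by simp
    then obtain x where x: "X = 2 * x" by blast
    define y where "y = x + N"
    have y: "Y = 2 * y" using Y x by (simp add: y_def)
    have M: "M ^ 2 = x + y" using X x by (simp add: y_def)
    \<comment> \<open>From \<open>4 * x * y = 5 * p * (2 * f)^4\<close>; this is the origin of the
      coefficient 20.\<close>
    have xy: "x * y = 20 * p * f ^ 4" using XY x y f by (simp add: power_mult_distrib)
    have "coprime x y"
    proof (rule coprimeI_prime_nat)
      fix q assume q: "prime q" "q dvd x" "q dvd y"
      then have "q dvd M ^ 2" "q dvd N" using M y_def by (metis dvd_add, metis dvd_add_right_iff)
      with q prime_factor prime_dvd_power show False by blast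
    qed
    then obtain d d' u v where *: "x = d * u ^ 4" "y = d' * v ^ 4" "d * d' = 20 * p" "u * v = f"
      using coprime_mult_eq_mult_power_nat[OF _ xy] p_pos by (metis mult_pos_pos zero_less_numeral)
    have "coprime u v" "coprime d d'" using \<open>coprime x y\<close> * by simp_all
    moreover have "M ^ 2 = d * u ^ 4 + d' * v ^ 4" using M * by simp
    ultimately have "d = 1 \<and> d' = 20 * p \<or> d = 20 * p \<and> d' = 1"
      using plus_quartic_descent_coefficients * \<open>odd M\<close> by blast
    then show ?thesis
      using that[of u v] that[of v u] M * f by (auto simp: ac_simps)
  qed
qed

text \<open>The numbers \<open>x = (M - u^2) / 2\<close> and \<open>y = (M + u^2) / 2\<close> are
  coprime, with product \<open>5 * p * v^4\<close> and difference \<open>u^2\<close>. Writing them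
  as coefficients times fourth powers gives the quartic of
  \<open>minus_quartic_descent_coefficients\<close>.\<close>

lemma quartic_second_descent:
  fixes M u v :: nat
  assumes "coprime M u" "odd M" "v > 0" and eq: "M ^ 2 = u ^ 4 + 20 * p * v ^ 4"
  obtains r s where "u ^ 2 + 5 * p * r ^ 4 = s ^ 4" "r * s = v" "coprime s r"
proof -
  have "odd (M ^ 2)" using \<open>odd M\<close> by simp
  then have "odd (u ^ 2)" using eq by auto
  have "(u ^ 2) ^ 2 < M ^ 2" using eq p_pos \<open>v > 0\<close> by (simp flip: power_mult)
  then have "u ^ 2 < M" using power_less_imp_less_base by blast
  moreover have "even (M - u ^ 2)" using \<open>odd M\<close> \<open>odd (u ^ 2)\<close> calculation by simp
  ultimately obtain x where x: "M = u ^ 2 + 2 * x"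
    by (metis dvdE le_add_diff_inverse less_imp_le)
  define y where "y = u ^ 2 + x"
  have "M ^ 2 = (u ^ 2) ^ 2 + 4 * (x * y)" unfolding x y_def by (simp add: power2_eq_square algebra_simps)
  then have xy: "x * y = 5 * p * v ^ 4" using eq by (simp flip: power_mult)
  have "coprime x y"
  proof (rule coprimeI_prime_nat)
    fix q assume q: "prime q" "q dvd x" "q dvd y"
    then have "q dvd u ^ 2" unfolding y_def using dvd_add_left_iff by blast
    then have "q dvd u" "q dvd M" using q x prime_dvd_power by auto
    with \<open>coprime M u\<close> q(1) show False
      using coprime_common_divisor not_prime_unit by blast
  qed
  then obtain d d' r s where *: "x = d * r ^ 4" "y = d' * s ^ 4" "d * d' = 5 * p" "r * s = v"
    using coprime_mult_eq_mult_power_nat[OF _ xy] p_pos by (metis mult_pos_pos zero_less_numeral)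
  have "coprime s r" using \<open>coprime x y\<close> * by (simp add: coprime_commute)
  moreover have "u ^ 2 + d * r ^ 4 = d' * s ^ 4" using * y_def by simp
  ultimately have "d' = 1 \<and> d = 5 * p"
    using minus_quartic_descent_coefficients[of d' d s r u] * by (simp add: mult.commute)
  with that[of r s] \<open>u ^ 2 + d * r ^ 4 = d' * s ^ 4\<close> * \<open>coprime s r\<close> show ?thesis by simp
qed

lemma no_quartic_solution:
  fixes M N e :: nat
  assumes "coprime M e" "e > 0"
  shows "N ^ 2 + 5 * p * e ^ 4 \<noteq> M ^ 4"
  using assms
proof (induction e arbitrary: M N rule: less_induct)
  case (less e)
  show ?case
  proof
    assume "N ^ 2 + 5 * p * e ^ 4 = M ^ 4"
    with less.prems obtain u v where uv: "M ^ 2 = u ^ 4 + 20 * p * v ^ 4" "e = 2 * (u * v)"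
      by (rule quartic_first_descent)
    have "u > 0" "v > 0" using uv(2) \<open>e > 0\<close> by auto
    have "coprime M u" "odd M" using uv(2) \<open>coprime M e\<close> by auto
    then obtain r s where rs: "u ^ 2 + 5 * p * r ^ 4 = s ^ 4" "r * s = v" "coprime s r"
      using quartic_second_descent \<open>v > 0\<close> uv(1) by blast
    have "r > 0" "s > 0" using rs(2) \<open>v > 0\<close> by auto
    \<comment> \<open>The descent is strict because of the factor 2 in
      \<open>e = 2 * (u * v)\<close>.\<close>
    have "r \<le> r * s" using \<open>s > 0\<close> by simp
    also have "r * s \<le> u * v" using rs(2) \<open>u > 0\<close> by simp
    also have "\<dots> < e" using uv(2) \<open>e > 0\<close> by linarith
    finally show False using less.IH[of r s u] rs \<open>r > 0\<close> by blast
  qed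
qed

lemma no_general_quartic_solution:
  fixes g h m e n :: nat
  assumes "g * h = 5 * p" "coprime m e" "m > 0" "e > 0"
  shows "n ^ 2 + h * e ^ 4 \<noteq> g * m ^ 4"
  using minus_quartic_descent_coefficients[OF assms(1,2), of n] no_quartic_solution[OF assms(2,4), of n] by auto

section \<open>From rational points to quartics\<close>

text \<open>Here \<open>a\<close>, \<open>b\<close> stand for the absolute numerator and denominator
  of \<open>x\<close>, and \<open>D\<close> for the absolute value of \<open>a^2 - 5 p b^2\<close>.
  Stripping common factors makes \<open>b\<close>, \<open>a / g\<close> and \<open>D / g\<close>
  squares, where \<open>g = gcd a (5 * p)\<close>. The two signs give the same quartic with
  \<open>g\<close> and \<open>h\<close> exchanged.\<close>

lemma no_square_value:
  fixes a b D w :: nat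
  assumes "coprime a b" "a > 0" "b > 0" and w: "a * b * D = w ^ 2"
    and D: "a ^ 2 = D + 5 * p * b ^ 2 \<or> 5 * p * b ^ 2 = D + a ^ 2"
  shows False
proof -
  have "coprime b D"
  proof (rule coprimeI_prime_nat)
    fix q assume q: "prime q" "q dvd b" "q dvd D"
    then have "q dvd 5 * p * b ^ 2" by (simp add: power2_eq_square)
    then have "q dvd a ^ 2" using D q(3) by (metis dvd_add dvd_add_right_iff)
    then have "q dvd a" using q(1) prime_dvd_power by blast
    with q \<open>coprime a b\<close> show False using coprime_common_divisor not_prime_unit by blast
  qed
  then have "coprime b (a * D)" using \<open>coprime a b\<close> by (simp add: coprime_commute)
  moreover have "b * (a * D) = 1 * w ^ 2" using w by (simp add: ac_simps)
  ultimately obtain e w' where e: "b = e ^ 2" and w': "a * D = w' ^ 2"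
    by (rule coprime_mult_eq_mult_power_nat) auto
  \<comment> \<open>As \<open>a\<close> is coprime to \<open>b\<close>, a common factor of
    \<open>a\<close> and \<open>D\<close> can only come from \<open>5 * p\<close>; dividing both by
    \<open>g\<close> makes them coprime.\<close>
  define g where "g = gcd a (5 * p)"
  have "g > 0" using \<open>a > 0\<close> by (simp add: g_def)
  obtain a' h where a: "a = a' * g" and h: "5 * p = h * g" and "coprime a' h"
    using gcd_coprime_exists[of a "5 * p"] \<open>g > 0\<close> unfolding g_def by blast
  have "g dvd D"
  proof -
    have "g dvd a ^ 2" "g dvd 5 * p * b ^ 2" unfolding h by (simp_all add: a power2_eq_square)
    then show ?thesis using D by (metis dvd_add_left_iff)
  qed
  then obtain D' where D': "D = g * D'" by blast
  have "g * (g * a' ^ 2) = g * (D' + h * b ^ 2) \<or> g * (h * b ^ 2) = g * (D' + g * a' ^ 2)"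
    using D unfolding h D' a by (simp add: power2_eq_square algebra_simps)
  then have D'_eq: "g * a' ^ 2 = D' + h * b ^ 2 \<or> h * b ^ 2 = D' + g * a' ^ 2"
    using \<open>g > 0\<close> by simp
  have "coprime a' b" using \<open>coprime a b\<close> a by simp
  have "coprime a' D'"
  proof (rule coprimeI_prime_nat)
    fix q assume q: "prime q" "q dvd a'" "q dvd D'"
    then have "q dvd g * a' ^ 2" by (simp add: power2_eq_square)
    then have "q dvd h * b ^ 2" using D'_eq q(3) by (metis dvd_add dvd_add_right_iff)
    then have "q dvd h \<or> q dvd b" using q(1) prime_dvd_mult_iff prime_dvd_power by blast
    with q \<open>coprime a' h\<close> \<open>coprime a' b\<close> show False
      using coprime_common_divisor not_prime_unit by blast
  qed
  have "g ^ 2 * (a' * D') = w' ^ 2" using w' a D' by (simp add: power2_eq_square ac_simps)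
  moreover from this have "g dvd w'" by (metis dvd_triv_left pow_divides_pow_iff zero_less_numeral)
  then obtain w'' where "w' = g * w''" by blast
  ultimately have "a' * D' = 1 * w'' ^ 2" using \<open>g > 0\<close> by (simp add: power_mult_distrib)
  with \<open>coprime a' D'\<close> obtain m n where m: "a' = m ^ 2" and n: "D' = n ^ 2"
    by (rule coprime_mult_eq_mult_power_nat) auto
  have "m > 0" "e > 0" using m e a \<open>a > 0\<close> \<open>b > 0\<close> by (auto intro: gr0I)
  have "coprime m e" using \<open>coprime a' b\<close> m e by simp
  have "g * m ^ 4 = n ^ 2 + h * e ^ 4 \<or> h * e ^ 4 = n ^ 2 + g * m ^ 4"
    using D'_eq unfolding m n e by (simp flip: power_mult)
  then show False
    using no_general_quartic_solution[of g h m e n] no_general_quartic_solution[of h g e m n]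
      h \<open>m > 0\<close> \<open>e > 0\<close> \<open>coprime m e\<close> by (auto simp: ac_simps coprime_commute)
qed

lemma rational_point_x_eq_0:
  fixes x y :: rat
  assumes "y ^ 2 = x ^ 3 - 5 * of_nat p * x"
  shows "x = 0"
proof (rule ccontr)
  assume "x \<noteq> 0"
  obtain a b where "quotient_of x = (a, b)" by force
  then have x: "x = of_int a / of_int b" and "b > 0" and "coprime a b"
    by (simp_all add: quotient_of_div quotient_of_denom_pos quotient_of_coprime)
  define z where "z = a * b * (a ^ 2 - 5 * int p * b ^ 2)"
  have "(y * of_int b ^ 2) ^ 2 = of_int z"
  proof -
    have "(y * of_int b ^ 2) ^ 2 = (x ^ 3 - 5 * of_nat p * x) * of_int b ^ 4"
      using assms by (simp add: power_mult_distrib flip: power_mult)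
    also have "\<dots> = (x * of_int b) ^ 3 * of_int b - 5 * of_nat p * (x * of_int b) * of_int b ^ 3"
      by (simp add: power3_eq_cube power4_eq_xxxx algebra_simps)
    also have "x * of_int b = of_int a" using x \<open>b > 0\<close> by simp
    also have "(of_int a ^ 3 * of_int b - 5 * of_nat p * of_int a * of_int b ^ 3 :: rat) = of_int z"
      by (simp add: z_def power2_eq_square power3_eq_cube algebra_simps)
    finally show ?thesis .
  qed
  moreover obtain c d where cd: "quotient_of (y * of_int b ^ 2) = (c, d)" by force
  ultimately have "(of_int c / of_int d :: rat) ^ 2 = of_int z" using quotient_of_div by metis
  moreover have "d > 0" "coprime c d"
    using cd by (simp_all add: quotient_of_denom_pos quotient_of_coprime)
  ultimately have "(of_int (c ^ 2) :: rat) = of_int (z * d ^ 2)"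
    by (simp add: power_divide field_simps)
  then have c: "c ^ 2 = z * d ^ 2" by (simp only: of_int_eq_iff)
  \<comment> \<open>A rational number whose square is an integer is itself an integer.\<close>
  then have "d ^ 2 dvd c ^ 2" by simp
  moreover have "coprime (c ^ 2) (d ^ 2)" using \<open>coprime c d\<close> by simp
  ultimately have "is_unit (d ^ 2)" by (meson coprime_common_divisor dvd_refl)
  then have "d ^ 2 = 1" by simp
  with c have z: "z = c ^ 2" by simp
  \<comment> \<open>Absolute values move the problem to natural numbers; the lost sign returns as
    the disjunction in \<open>no_square_value\<close>.\<close>
  define D where "D = nat \<bar>a ^ 2 - 5 * int p * b ^ 2\<bar>"
  have "nat \<bar>z\<bar> = nat \<bar>a\<bar> * nat \<bar>b\<bar> * D"
    unfolding z_def D_def by (simp add: abs_mult nat_mult_distrib)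
  moreover have "nat \<bar>z\<bar> = (nat \<bar>c\<bar>) ^ 2" using z by (simp flip: nat_power_eq)
  ultimately have "nat \<bar>a\<bar> * nat \<bar>b\<bar> * D = (nat \<bar>c\<bar>) ^ 2" by simp
  moreover have "coprime (nat \<bar>a\<bar>) (nat \<bar>b\<bar>)" using \<open>coprime a b\<close> by simp
  moreover have "nat \<bar>a\<bar> > 0" "nat \<bar>b\<bar> > 0" using \<open>b > 0\<close> \<open>x \<noteq> 0\<close> x by auto
  moreover have "(nat \<bar>a\<bar>) ^ 2 = D + 5 * p * (nat \<bar>b\<bar>) ^ 2 \<or>
      5 * p * (nat \<bar>b\<bar>) ^ 2 = D + (nat \<bar>a\<bar>) ^ 2"
  proof -
    have "a ^ 2 = int D + 5 * int p * b ^ 2 \<or> 5 * int p * b ^ 2 = int D + a ^ 2"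
      unfolding D_def by simp linarith
    then have "int ((nat \<bar>a\<bar>) ^ 2) = int (D + 5 * p * (nat \<bar>b\<bar>) ^ 2) \<or>
        int (5 * p * (nat \<bar>b\<bar>) ^ 2) = int (D + (nat \<bar>a\<bar>) ^ 2)" by simp
    then show ?thesis by (simp only: of_nat_eq_iff)
  qed
  ultimately show False using no_square_value by blast
qed

lemma carrier_E_group: "carrier (E_group p) = {Infinity, Affine 0 0}"
proof -
  have "x = 0 \<and> y = 0" if "y ^ 2 = x ^ 3 + (- 5 * of_nat p) * x + 0" for x y :: rat
    using rational_point_x_eq_0[of y x] that by simp
  then show ?thesis by (auto simp: E_group_def mordell_weil_group_def ec_points_def)
qed

end

section \<open>Group structure and rank\<close>

text \<open>A point with \<open>y = 0\<close> is its own inverse, so the group laws reduce to a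
  finite check and every element is killed by 2. The group is thus its own torsion part.\<close>

lemma two_element_ec_group_has_rank_0:
  fixes a b :: "'a :: field_char_0"
  defines "G \<equiv> mordell_weil_group a b"
  assumes carrier: "carrier G = {Infinity, Affine x 0}"
  shows "has_rank G 0"
proof -
  have mult: "monoid.mult G = ec_add a" and one: "\<one>\<^bsub>G\<^esub> = Infinity"
    by (simp_all add: G_def mordell_weil_group_def)
  interpret comm_group G
    by (rule comm_groupI) (auto simp: carrier mult one)
  have "finitely_generated_group G"
    unfolding finitely_generated_group_def
  proof (intro exI conjI)
    show "finite (carrier G)" by (simp add: carrier)
    show "generate G (carrier G) = carrier G"
      using generate_incl[of "carrier G"] by (auto intro: generate.incl)
  qed simp
  moreover have torsion: "torsion_part G = G"
  proof -
    have "y [^]\<^bsub>G\<^esub> (2::nat) = \<one>\<^bsub>G\<^esub>" if "y \<in> carrier G" for y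
      using that by (auto simp: carrier mult one numeral_2_eq_2)
    then have "{y \<in> carrier G. \<exists>n::nat. n > 0 \<and> y [^]\<^bsub>G\<^esub> n = \<one>\<^bsub>G\<^esub>} = carrier G"
      using zero_less_numeral by blast
    then show ?thesis unfolding torsion_part_def by simp
  qed
  moreover have "G \<cong> product_group {..<0::nat} (\<lambda>_. integer_group) \<times>\<times> G"
  proof -
    \<comment> \<open>The product over the empty index set is trivial; its only element is the
      function that is \<open>undefined\<close> everywhere.\<close>
    have "(\<lambda>y. ((\<lambda>_. undefined), y)) \<in> iso G (product_group {..<0::nat} (\<lambda>_. integer_group) \<times>\<times> G)"
      by (auto simp: iso_def hom_def bij_betw_def inj_on_def restrict_def)
    then show ?thesis by (auto simp: is_iso_def)
  qed
  ultimately show ?thesis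
    unfolding has_rank_def using comm_group_axioms by simp
qed

theorem theorem1p1:
  fixes p :: nat
  assumes "prime p" and "odd p"
    and "[p = 7] (mod 40) \<or> [p = 23] (mod 40)"
  shows "has_rank (E_group p) 0 \<and> finite (carrier (E_group p))"
proof -
  have "p mod 40 = 7 \<or> p mod 40 = 23" using assms(3) by (simp add: cong_def)
  \<comment> \<open>Both 7 and 23 are 7 modulo 8, and modulo 5 they are the two nonresidues 2 and
    3.\<close>
  then have "p mod 8 = 7" "p mod 5 = 2 \<or> p mod 5 = 3" by presburger+
  with \<open>prime p\<close> have carrier: "carrier (E_group p) = {Infinity, Affine 0 0}"
    by (rule carrier_E_group)
  then show ?thesis
    using two_element_ec_group_has_rank_0[of "- 5 * of_nat p" 0 0] by (simp add: E_group_def)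
qed

end
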